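(* For every $\epsilon>0$ there exists $c>0$ such that $Q\big(\mathrm{DYCK}_{c\log n,\,n}\big)=\Omega(n^{1-\epsilon})$.
   Context: For $x=x_1\cdots x_n\in\{0,1\}^n$, interpret $x_i=0$ as "(" and $x_i=1$ as ")". Let $f(y)=|y|_0-|y|_1$. $\mathrm{DYCK}_{k,n}(x)=1$ iff $f(x)=0$ and every prefix $p$ of $x$ satisfies $0\le f(p)\le k$. $Q(g)$ denotes the bounded-error (success probability at least $2/3$) quantum query complexity of $g$ in the standard oracle model.
   Formalization: The bound is stated for n tending to infinity along even n only; for odd n no word satisfies f(x)=0, so DYCK is constantly 0, Q is 0, and the lower bound over all n would be false. *)

theory Defs
  imports
    "HOL-Library.Sublist"
    "HOL-Library.Landau_Symbols"
    "Jordan_Normal_Form.Schur_Decomposition"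
begin

text \<open>The letter 0, an opening bracket, is \<^term>\<open>False\<close>; the letter 1, a closing bracket, is
  \<^term>\<open>True\<close>.  For odd \<open>n\<close> the predicate \<open>DYCK k n\<close> holds of no word, so it has query complexity 0
  and asymptotic lower bounds only make sense along even \<open>n\<close>.\<close>

definition balance :: "bool list \<Rightarrow> int" where
  "balance y = int (count_list y False) - int (count_list y True)"

definition DYCK :: "nat \<Rightarrow> nat \<Rightarrow> bool list \<Rightarrow> bool" where
  "DYCK k n x \<longleftrightarrow> length x = n \<and> balance x = 0 \<and>
     (\<forall>p. prefix p x \<longrightarrow> 0 \<le> balance p \<and> balance p \<le> int k)"

definition unitary :: "nat \<Rightarrow> complex mat \<Rightarrow> bool" where
  "unitary d U \<longleftrightarrow> U \<in> carrier_mat d d \<and> U * mat_adjoint U = 1\<^sub>m d \<and> mat_adjoint U * U = 1\<^sub>m d"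

text \<open>The state space of an algorithm with input length \<open>n\<close> and a workspace of dimension \<open>w\<close>
  has dimension \<open>2 * n * w\<close>.  The basis state \<open>|i, b, z\<rangle>\<close> with query index \<open>i < n\<close> (positions
  of the input are counted from 0), target bit \<open>b < 2\<close> and workspace content \<open>z < w\<close> is the
  unit vector with index \<open>b + 2 * (i + n * z)\<close>.\<close>

definition query_index :: "nat \<Rightarrow> nat \<Rightarrow> nat" where
  "query_index n j = (j div 2) mod n"

text \<open>Since the target bit is the lowest bit of the index,
  \<open>|i, b, z\<rangle> \<mapsto> |i, b \<oplus> x\<^sub>i, z\<rangle>\<close> is an exclusive or on indices.\<close>

definition query_mat :: "nat \<Rightarrow> nat \<Rightarrow> bool list \<Rightarrow> complex mat" where
  "query_mat n w x = mat (2 * n * w) (2 * n * w)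
     (\<lambda>(r, j). if r = xor j (of_bool (x ! query_index n j)) then 1 else 0)"

text \<open>The state \<open>U\<^sub>T O\<^sub>x U\<^bsub>T-1\<^esub> \<dots> U\<^sub>1 O\<^sub>x U\<^sub>0 |0, 0, 0\<rangle>\<close> after \<open>T\<close> queries.\<close>

primrec query_state ::
  "nat \<Rightarrow> nat \<Rightarrow> (nat \<Rightarrow> complex mat) \<Rightarrow> bool list \<Rightarrow> nat \<Rightarrow> complex vec" where
  "query_state n w U x 0 = U 0 *\<^sub>v unit_vec (2 * n * w) 0"
| "query_state n w U x (Suc T) = U (Suc T) *\<^sub>v (query_mat n w x *\<^sub>v query_state n w U x T)"

text \<open>The final state is measured in the computational basis and the output is read off from the
  outcome \<open>j\<close> as \<open>out j\<close>.\<close>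

definition output_prob ::
  "nat \<Rightarrow> nat \<Rightarrow> (nat \<Rightarrow> complex mat) \<Rightarrow> (nat \<Rightarrow> bool) \<Rightarrow> nat \<Rightarrow> bool list \<Rightarrow> bool \<Rightarrow> real" where
  "output_prob n w U out T x a =
     (\<Sum>j | j < 2 * n * w \<and> out j = a. (cmod (query_state n w U x T $ j))\<^sup>2)"

definition computable_with_queries :: "nat \<Rightarrow> (bool list \<Rightarrow> bool) \<Rightarrow> nat \<Rightarrow> bool" where
  "computable_with_queries n g T \<longleftrightarrow>
     (\<exists>w U out. w \<ge> 1 \<and> (\<forall>t\<le>T. unitary (2 * n * w) (U t)) \<and>
        (\<forall>x. length x = n \<longrightarrow> output_prob n w U out T x (g x) \<ge> 2 / 3))"

text \<open>Here \<open>g\<close> is only evaluated on inputs of length \<open>n\<close>.  For \<open>n \<ge> 1\<close> the set below is nonempty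
  (query all of the input); for \<open>n = 0\<close> the state space is trivial, the set is empty, and its
  infimum in \<^typ>\<open>nat\<close> is 0.\<close>

definition quantum_query_complexity :: "nat \<Rightarrow> (bool list \<Rightarrow> bool) \<Rightarrow> nat" where
  "quantum_query_complexity n g = Inf {T. computable_with_queries n g T}"

end

theory Submission
  imports Defs "HOL-Library.Countable"
begin

text \<open>Ambainis' adversary argument for words at Hamming distance 1: if every word of \<open>X\<close> becomes a
  word of \<open>Y\<close> under at least \<open>d\<close> single flips and vice versa, then separating \<open>X\<close> from \<open>Y\<close> takes
  \<open>\<Omega>(d)\<close> queries.  Indeed the total squared distance of the states over the pairs starts at 0, has to
  become proportional to the number of pairs, and grows by at most \<open>2 (|X| + |Y|)\<close> per query.

  Words with many such flips and a low path come from iterating the problem of telling \<open>m\<close> from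
  \<open>m + 1\<close> ones among \<open>2 m\<close> bits.  If the blocks encoding the bits have balance 1 or -1, then so has
  their concatenation followed by one opening bracket.  Hence \<open>l\<close> levels give length about
  \<open>(2 m)^l\<close>, height \<open>O(m l)\<close> and at least \<open>m^l\<close> flips; framed by opening and closing brackets,
  the gadgets of balance 1 become Dyck words and those of balance -1 do not.  A large constant \<open>m\<close>
  gives the exponent \<open>1 - \<epsilon>\<close>.\<close>

subsection \<open>The adversary bound\<close>

text \<open>Two kinds of \<open>J\<close> matter: the outcomes with a given output, where this is
  the output probability, and the indices with a given query position, where it is the weight with
  which that position is queried.\<close>

definition mass :: "nat set \<Rightarrow> complex vec \<Rightarrow> real" where
  "mass J v = (\<Sum>j\<in>J. (cmod (v $ j))\<^sup>2)"

definition flip :: "nat \<Rightarrow> bool list \<Rightarrow> bool list" where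
  "flip i x = x[i := \<not> x ! i]"

lemma length_flip [simp]: "length (flip i x) = length x"
  by (simp add: flip_def)

lemma flip_flip [simp]: "flip i (flip i x) = x"
  by (cases "i < length x") (simp_all add: flip_def list_update_beyond)

lemma mass_nonneg [simp]: "0 \<le> mass J v"
  by (simp add: mass_def sum_nonneg)

lemma mass_mono: "finite K \<Longrightarrow> J \<subseteq> K \<Longrightarrow> mass J v \<le> mass K v"
  unfolding mass_def by (rule sum_mono2) auto

lemma mat_adjoint_mult_index:
  assumes "U \<in> carrier_mat d d" "j < d" "k < d"
  shows "(mat_adjoint U * U) $$ (j, k) = (\<Sum>r<d. cnj (U $$ (r, j)) * U $$ (r, k))"
  using assms
  by (auto simp: mat_adjoint_def scalar_prod_def mat_of_rows_index lessThan_atLeast0 intro!: sum.cong)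

text \<open>The columns of \<open>U\<close> are orthonormal: once the squared norm is expanded into
  a triple sum, summing over the rows \<open>r\<close> first leaves only the diagonal terms.\<close>

lemma unitary_preserves_mass:
  assumes U: "unitary d U" and v: "v \<in> carrier_vec d"
  shows "mass {..<d} (U *\<^sub>v v) = mass {..<d} v"
proof -
  have Uc: "U \<in> carrier_mat d d" and UU: "mat_adjoint U * U = 1\<^sub>m d"
    using U by (auto simp: unitary_def)
  have orth: "(\<Sum>r<d. cnj (U $$ (r, j)) * U $$ (r, k)) = of_bool (j = k)" if "j < d" "k < d" for j k
    using mat_adjoint_mult_index[OF Uc that, symmetric] that by (simp add: UU)
  have comp: "(U *\<^sub>v v) $ r = (\<Sum>j<d. U $$ (r, j) * v $ j)" if "r < d" for r
    using Uc v that by (auto simp: scalar_prod_def lessThan_atLeast0 intro!: sum.cong)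
  have "complex_of_real (mass {..<d} (U *\<^sub>v v))
      = (\<Sum>r<d. cnj (\<Sum>j<d. U $$ (r, j) * v $ j) * (\<Sum>k<d. U $$ (r, k) * v $ k))"
    unfolding mass_def of_real_sum complex_norm_square
    by (rule sum.cong) (simp_all add: comp mult.commute)
  also have "\<dots> = (\<Sum>r<d. \<Sum>j<d. \<Sum>k<d.
      (cnj (v $ j) * v $ k) * (cnj (U $$ (r, j)) * U $$ (r, k)))"
    by (simp only: cnj_sum complex_cnj_mult sum_product) (simp add: mult_ac)
  also have "\<dots> = (\<Sum>j<d. \<Sum>r<d. \<Sum>k<d.
      (cnj (v $ j) * v $ k) * (cnj (U $$ (r, j)) * U $$ (r, k)))"
    by (rule sum.swap)
  also have "\<dots> = (\<Sum>j<d. \<Sum>k<d. \<Sum>r<d.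
      (cnj (v $ j) * v $ k) * (cnj (U $$ (r, j)) * U $$ (r, k)))"
    by (intro sum.cong refl sum.swap)
  also have "\<dots> = (\<Sum>j<d. \<Sum>k<d. (cnj (v $ j) * v $ k) * of_bool (j = k))"
    by (intro sum.cong refl) (simp add: sum_distrib_left[symmetric] orth)
  also have "\<dots> = (\<Sum>j<d. cnj (v $ j) * v $ j)"
    by (intro sum.cong refl) (simp add: of_bool_def sum.delta if_distrib[of "(*) _"] cong: if_cong)
  also have "\<dots> = complex_of_real (mass {..<d} v)"
    by (simp add: mass_def complex_norm_square mult.commute of_real_sum del: of_real_power)
  finally show ?thesis by (simp only: of_real_eq_iff)
qed

lemma unitary_preserves_mass_diff:
  assumes U: "unitary d U" and v: "v \<in> carrier_vec d" and w: "w \<in> carrier_vec d"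
  shows "mass {..<d} (U *\<^sub>v v - U *\<^sub>v w) = mass {..<d} (v - w)"
proof -
  have "U *\<^sub>v v - U *\<^sub>v w = U *\<^sub>v (v - w)"
    using U v w by (auto simp: unitary_def mult_minus_distrib_mat_vec)
  with unitary_preserves_mass[OF U, of "v - w"] v w show ?thesis by simp
qed

lemma mass_diff_le: 
  assumes "dim_vec v = d" "dim_vec w = d" "J \<subseteq> {..<d}"
  shows "mass J (v - w) \<le> 2 * mass J v + 2 * mass J w"
proof -
  have "(cmod (a - b))\<^sup>2 \<le> 2 * (cmod a)\<^sup>2 + 2 * (cmod b)\<^sup>2" for a b
  proof -
    have "(cmod (a - b))\<^sup>2 \<le> (cmod a + cmod b)\<^sup>2"
      by (intro power_mono norm_triangle_ineq4) simp
    also have "\<dots> \<le> 2 * (cmod a)\<^sup>2 + 2 * (cmod b)\<^sup>2"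
      using sum_squares_bound[of "cmod a" "cmod b"] by (simp add: power2_sum)
    finally show ?thesis .
  qed
  then have "mass J (v - w) \<le> (\<Sum>j\<in>J. 2 * (cmod (v $ j))\<^sup>2 + 2 * (cmod (w $ j))\<^sup>2)"
    unfolding mass_def using assms by (intro sum_mono) auto
  then show ?thesis
    by (simp add: mass_def sum.distrib sum_distrib_left)
qed

section \<open>The query matrix as an involution of basis indices\<close>

lemma xor_of_bool_div_2 [simp]: "xor j (of_bool b) div 2 = (j :: nat) div 2"
  by (cases b; cases "even j") (auto simp: xor_one_eq simp del: One_nat_def elim!: oddE evenE)

lemma xor_of_bool_less:
  fixes j :: nat
  assumes "j < 2 * m" shows "xor j (of_bool b) < 2 * m"
  using assms xor_of_bool_div_2[of j b] by (metis div_less_iff_less_mult mult.commute zero_less_numeral)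

lemma xor_of_bool_self [simp]: "xor (xor j (of_bool b)) (of_bool b) = (j :: nat)"
  by (simp add: xor.assoc)

lemma query_index_xor [simp]: "query_index n (xor j (of_bool b)) = query_index n j"
  by (simp add: query_index_def)

lemma query_index_less: "n > 0 \<Longrightarrow> query_index n j < n"
  by (simp add: query_index_def)

lemma query_mat_carrier [simp]: "query_mat n w x \<in> carrier_mat (2 * n * w) (2 * n * w)"
  by (simp add: query_mat_def)

text \<open>The xor leaves the query position unchanged, so the index map is an involution and its
  permutation matrix acts on coordinates by the same map.\<close>

lemma query_mat_mult_index:
  assumes v: "v \<in> carrier_vec (2 * n * w)" and r: "r < 2 * n * w"
  shows "(query_mat n w x *\<^sub>v v) $ r = v $ xor r (of_bool (x ! query_index n r))"
proof -
  let ?s = "xor r (of_bool (x ! query_index n r))"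
  have s: "?s < 2 * n * w" using xor_of_bool_less[of r "n * w"] r by (simp add: mult.assoc)
  have eq: "r = xor j (of_bool (x ! query_index n j)) \<longleftrightarrow> j = ?s" for j
    by (metis query_index_xor xor_of_bool_self)
  have "(query_mat n w x *\<^sub>v v) $ r = (\<Sum>j<2 * n * w. (if j = ?s then 1 else 0) * v $ j)"
    using v r by (auto simp: query_mat_def scalar_prod_def lessThan_atLeast0 eq intro!: sum.cong)
  also have "\<dots> = v $ ?s" using s by (simp add: if_distrib[of "\<lambda>a. a * _"] cong: if_cong)
  finally show ?thesis .
qed

lemma sum_reindex_xor:
  fixes f :: "nat \<Rightarrow> real" and b :: "nat \<Rightarrow> bool"
  assumes b: "\<And>j. b (xor j (of_bool (b j))) = b j"
    and J: "\<And>j. j \<in> J \<Longrightarrow> xor j (of_bool (b j)) \<in> J"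
  shows "(\<Sum>j\<in>J. f (xor j (of_bool (b j)))) = (\<Sum>j\<in>J. f j)"
  by (rule sum.reindex_bij_witness[where i = "\<lambda>j. xor j (of_bool (b j))"
        and j = "\<lambda>j. xor j (of_bool (b j))"]) (auto simp: b J)

text \<open>A query permutes the basis states within each query position, so the weight on any set
  \<open>I\<close> of positions is invariant. This is applied to one position, to all but one, and
  to all.\<close>

lemma mass_query:
  assumes v: "v \<in> carrier_vec (2 * n * w)" and J: "J = {j. j < 2 * n * w \<and> query_index n j \<in> I}"
  shows "mass J (query_mat n w x *\<^sub>v v) = mass J v"
proof -
  have "mass J (query_mat n w x *\<^sub>v v) = (\<Sum>j\<in>J. (cmod (v $ xor j (of_bool (x ! query_index n j))))\<^sup>2)"
    unfolding mass_def by (rule sum.cong) (auto simp: J query_mat_mult_index[OF v])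
  also have "\<dots> = mass J v"
    unfolding mass_def
    by (rule sum_reindex_xor[where f = "\<lambda>j. (cmod (v $ j))\<^sup>2"])
       (auto simp: J xor_of_bool_less[of _ "n * w", unfolded mult.assoc[symmetric]])
  finally show ?thesis .
qed

definition index_space :: "nat \<Rightarrow> nat \<Rightarrow> nat \<Rightarrow> nat set" where
  "index_space n w i = {j. j < 2 * n * w \<and> query_index n j = i}"

lemma sum_mass_index_space:
  assumes "n > 0"
  shows "(\<Sum>i<n. mass (index_space n w i) v) = mass {..<2 * n * w} v"
proof -
  have "(\<Sum>i<n. mass (index_space n w i) v)
      = (\<Sum>i<n. \<Sum>j | j \<in> {..<2 * n * w} \<and> query_index n j = i. (cmod (v $ j))\<^sup>2)"
    by (simp add: mass_def index_space_def)
  also have "\<dots> = mass {..<2 * n * w} v"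
    unfolding mass_def using query_index_less[OF assms]
    by (intro sum.group) auto
  finally show ?thesis .
qed

text \<open>Away from position \<open>i\<close> both oracles act alike, so the difference is only
  permuted there. On position \<open>i\<close> nothing better than \<open>mass_diff_le\<close> is
  used, and this is the only source of growth.\<close>

lemma query_flip_diff:
  assumes v: "v \<in> carrier_vec (2 * n * w)" and u: "u \<in> carrier_vec (2 * n * w)"
  shows "mass {..<2 * n * w} (query_mat n w x *\<^sub>v v - query_mat n w (flip i x) *\<^sub>v u)
    \<le> mass {..<2 * n * w} (v - u)
      + 2 * mass (index_space n w i) v + 2 * mass (index_space n w i) u"
proof -
  let ?N = "2 * n * w" and ?I = "index_space n w i"
  let ?R = "{j. j < ?N \<and> query_index n j \<in> - {i}}"
  let ?v = "query_mat n w x *\<^sub>v v" and ?u = "query_mat n w (flip i x) *\<^sub>v u"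
  have split: "mass {..<?N} z = mass ?R z + mass ?I z" for z
    unfolding mass_def
    by (subst sum.union_disjoint[symmetric]) (auto simp: index_space_def intro!: sum.cong)
  have I: "?I = {j. j < ?N \<and> query_index n j \<in> {i}}" by (auto simp: index_space_def)
  have same: "flip i x ! query_index n j = x ! query_index n j" if "j \<in> ?R" for j
    using that by (auto simp: flip_def)
  have "mass ?R (?v - ?u) = mass ?R (query_mat n w x *\<^sub>v (v - u))"
    unfolding mass_def
  proof (rule sum.cong)
    fix j assume j: "j \<in> ?R"
    let ?s = "xor j (of_bool (x ! query_index n j))"
    have s: "?s < ?N"
      using j xor_of_bool_less[of j "n * w"] by (simp add: mult.assoc)
    have j': "j < ?N" using j by simp
    have vu: "v - u \<in> carrier_vec ?N" using u v by simp
    have "(?v - ?u) $ j = ?v $ j - ?u $ j"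
      using j' by (intro index_minus_vec) (simp add: query_mat_def)
    also have "\<dots> = v $ ?s - u $ ?s"
      by (simp only: query_mat_mult_index[OF v j'] query_mat_mult_index[OF u j'] same[OF j])
    also have "\<dots> = (v - u) $ ?s" using s u by simp
    also have "\<dots> = (query_mat n w x *\<^sub>v (v - u)) $ j"
      by (rule query_mat_mult_index[OF vu j', symmetric])
    finally show "(cmod ((?v - ?u) $ j))\<^sup>2 = (cmod ((query_mat n w x *\<^sub>v (v - u)) $ j))\<^sup>2"
      by simp
  qed simp
  also have "\<dots> = mass ?R (v - u)" using u v by (intro mass_query[where I = "- {i}"]) auto
  also have "\<dots> \<le> mass {..<?N} (v - u)" by (rule mass_mono) auto
  finally have "mass ?R (?v - ?u) \<le> mass {..<?N} (v - u)" .
  moreover have "mass ?I (?v - ?u) \<le> 2 * mass ?I ?v + 2 * mass ?I ?u"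
    by (rule mass_diff_le[of _ "?N"]) (auto simp: index_space_def query_mat_def)
  moreover have "mass ?I ?v = mass ?I v" "mass ?I ?u = mass ?I u"
    using mass_query[OF v I] mass_query[OF u I] by auto
  ultimately show ?thesis by (simp add: split[of "?v - ?u"])
qed

section \<open>States of an algorithm and the progress measure\<close>

lemma query_state_carrier:
  assumes "\<And>t. t \<le> T \<Longrightarrow> unitary (2 * n * w) (U t)" "t \<le> T"
  shows "query_state n w U x t \<in> carrier_vec (2 * n * w)"
proof -
  have "U t \<in> carrier_mat (2 * n * w) (2 * n * w)" using assms by (auto simp: unitary_def)
  then show ?thesis by (cases t) (auto intro!: carrier_vecI)
qed

lemma mass_query_state:
  assumes U: "\<And>t. t \<le> T \<Longrightarrow> unitary (2 * n * w) (U t)" and "t \<le> T" and pos: "0 < 2 * n * w"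
  shows "mass {..<2 * n * w} (query_state n w U x t) = 1"
  using \<open>t \<le> T\<close>
proof (induction t)
  case 0
  have "mass {..<2 * n * w} (unit_vec (2 * n * w) 0) = (\<Sum>j<2 * n * w. if j = 0 then 1 else 0)"
    unfolding mass_def using pos by (intro sum.cong) auto
  also have "\<dots> = 1" using pos by simp
  finally show ?case using unitary_preserves_mass[OF U[of 0]] 0 by simp
next
  case (Suc t)
  have c: "query_state n w U x t \<in> carrier_vec (2 * n * w)"
    using query_state_carrier[OF U] Suc.prems by simp
  have "mass {..<2 * n * w} (query_state n w U x (Suc t))
      = mass {..<2 * n * w} (query_mat n w x *\<^sub>v query_state n w U x t)"
    using unitary_preserves_mass[OF U[OF Suc.prems], of "query_mat n w x *\<^sub>v query_state n w U x t"] c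
      mult_mat_vec_carrier[OF query_mat_carrier c] by simp
  also have "\<dots> = mass {..<2 * n * w} (query_state n w U x t)"
    by (rule mass_query[OF c, where I = UNIV]) auto
  finally show ?case using Suc by simp
qed

text \<open>Expanding (s - 2t)^2 \<ge> 0 gives (s + t)^2 \<le> 3/2 s^2 + 3 t^2. Hence 2/3 \<le> 3/2
  * 1/3 + 3 D for the squared distance D on \<open>J\<close>, that is, D \<ge> 1/18.\<close>

lemma two_thirds_separation:
  assumes len: "dim_vec v = d" "dim_vec u = d" and J: "J \<subseteq> {..<d}"
    and v: "mass J v \<ge> 2 / 3" and u: "mass J u \<le> 1 / 3"
  shows "mass {..<d} (v - u) \<ge> 1 / 18"
proof -
  have "(cmod a)\<^sup>2 \<le> 3 / 2 * (cmod b)\<^sup>2 + 3 * (cmod (a - b))\<^sup>2" for a b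
  proof -
    have "(cmod a)\<^sup>2 \<le> (cmod b + cmod (a - b))\<^sup>2"
      using norm_triangle_ineq[of b "a - b"] by (intro power_mono) auto
    also have "\<dots> \<le> 3 / 2 * (cmod b)\<^sup>2 + 3 * (cmod (a - b))\<^sup>2"
      using zero_le_power2[of "cmod b - 2 * cmod (a - b)"]
      by (simp add: power2_eq_square algebra_simps)
    finally show ?thesis .
  qed
  then have "mass J v \<le> (\<Sum>j\<in>J. 3 / 2 * (cmod (u $ j))\<^sup>2 + 3 * (cmod ((v - u) $ j))\<^sup>2)"
    unfolding mass_def using len J by (intro sum_mono) auto
  also have "\<dots> = 3 / 2 * mass J u + 3 * mass J (v - u)"
    by (simp add: mass_def sum.distrib sum_distrib_left)
  finally have "mass J (v - u) \<ge> 1 / 18" using u v by simp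
  moreover have "mass J (v - u) \<le> mass {..<d} (v - u)" using J by (intro mass_mono) auto
  ultimately show ?thesis by simp
qed

lemma adversary_lower_bound:
  fixes d :: nat
  assumes comp: "computable_with_queries n g T"
    and X: "\<And>x. x \<in> X \<Longrightarrow> length x = n \<and> g x" "X \<noteq> {}"
    and Y: "\<And>y. y \<in> Y \<Longrightarrow> length y = n \<and> \<not> g y"
    and dX: "\<And>x. x \<in> X \<Longrightarrow> d \<le> card {i. i < n \<and> flip i x \<in> Y}"
    and dY: "\<And>y. y \<in> Y \<Longrightarrow> d \<le> card {i. i < n \<and> flip i y \<in> X}"
  shows "real d \<le> 72 * real T"
proof (cases "d = 0")
  case False
  obtain w U out where w: "w \<ge> 1" and U: "\<And>t. t \<le> T \<Longrightarrow> unitary (2 * n * w) (U t)"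
    and out: "\<And>x. length x = n \<Longrightarrow> output_prob n w U out T x (g x) \<ge> 2 / 3"
    using comp unfolding computable_with_queries_def by blast
  have n: "n > 0"
  proof (rule ccontr)
    assume "\<not> n > 0"
    with dX X(2) have "d \<le> 0" by fastforce
    with False show False by simp
  qed
  let ?N = "2 * n * w"
  have pos: "0 < ?N" using n w by simp
  define \<psi> where "\<psi> x t = query_state n w U x t" for x t
  have carrier: "\<psi> x t \<in> carrier_vec ?N" if "t \<le> T" for x t
    unfolding \<psi>_def using U that by (rule query_state_carrier)
  have one: "mass {..<?N} (\<psi> x t) = 1" if "t \<le> T" for x t
    unfolding \<psi>_def using U that pos by (rule mass_query_state)
  \<comment> \<open>\<open>R\<close> indexes the pairs at distance 1 by the word in \<open>X\<close>
    and the flipped position, \<open>R'\<close> by the word in \<open>Y\<close>. Flipping is a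
    bijection between them, so sums over the pairs can be charged to either side.\<close>
  define R where "R = (SIGMA x:X. {i. i < n \<and> flip i x \<in> Y})"
  define R' where "R' = (SIGMA y:Y. {i. i < n \<and> flip i y \<in> X})"
  define D where "D t = (\<Sum>(x, i)\<in>R. mass {..<?N} (\<psi> x t - \<psi> (flip i x) t))" for t
  have fin: "finite {x :: bool list. length x = n}"
    using finite_lists_length_eq[of "UNIV :: bool set" n] by simp
  have finX: "finite X" and finY: "finite Y"
    using X Y by (auto intro: finite_subset[OF _ fin])
  have finR: "finite R" and finR': "finite R'" using finX finY by (auto simp: R_def R'_def)
  have bij: "bij_betw (\<lambda>(x, i). (flip i x, i)) R R'"
    by (rule bij_betwI[where g = "\<lambda>(x, i). (flip i x, i)"]) (auto simp: R_def R'_def)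
  have cardX: "d * card X \<le> card R"
    using finX dX sum_bounded_below[of X d "\<lambda>x. card {i. i < n \<and> flip i x \<in> Y}"]
    by (simp add: R_def mult.commute)
  have cardY: "d * card Y \<le> card R"
    using finY dY sum_bounded_below[of Y d "\<lambda>x. card {i. i < n \<and> flip i x \<in> X}"]
      bij_betw_same_card[OF bij] by (simp add: R'_def mult.commute)
  \<comment> \<open>The state of one word has total weight 1 over all query positions, so its
    sensitive positions together carry at most 1.\<close>
  have sens: "(\<Sum>(x, i)\<in>(SIGMA x:Z. {i. i < n \<and> flip i x \<in> Z'}). mass (index_space n w i) (\<psi> x t)) \<le> card Z"
    if "t \<le> T" "finite Z" for t Z Z'
  proof -
    have "(\<Sum>(x, i)\<in>(SIGMA x:Z. {i. i < n \<and> flip i x \<in> Z'}). mass (index_space n w i) (\<psi> x t))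
        = (\<Sum>x\<in>Z. \<Sum>i | i < n \<and> flip i x \<in> Z'. mass (index_space n w i) (\<psi> x t))"
      using that by (subst sum.Sigma) auto
    also have "\<dots> \<le> (\<Sum>x\<in>Z. \<Sum>i<n. mass (index_space n w i) (\<psi> x t))"
      by (intro sum_mono sum_mono2) auto
    also have "\<dots> = card Z" by (simp add: sum_mass_index_space[OF n] one[OF that(1)])
    finally show ?thesis .
  qed
  have step: "D (Suc t) \<le> D t + 2 * real (card X) + 2 * real (card Y)" if "Suc t \<le> T" for t
  proof -
    have t: "t \<le> T" using that by simp
    have "D (Suc t) \<le> (\<Sum>(x, i)\<in>R. mass {..<?N} (\<psi> x t - \<psi> (flip i x) t)
        + 2 * mass (index_space n w i) (\<psi> x t) + 2 * mass (index_space n w i) (\<psi> (flip i x) t))"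
      unfolding D_def
    proof (intro sum_mono, clarify)
      fix x i
      note c = carrier[OF t]
      have q: "query_mat n w z *\<^sub>v \<psi> z t \<in> carrier_vec ?N" for z
        by (rule mult_mat_vec_carrier[OF query_mat_carrier c])
      have "mass {..<?N} (\<psi> x (Suc t) - \<psi> (flip i x) (Suc t))
          = mass {..<?N} (query_mat n w x *\<^sub>v \<psi> x t - query_mat n w (flip i x) *\<^sub>v \<psi> (flip i x) t)"
        using unitary_preserves_mass_diff[OF U[OF that] q q] by (simp add: \<psi>_def)
      also have "\<dots> \<le> mass {..<?N} (\<psi> x t - \<psi> (flip i x) t)
        + 2 * mass (index_space n w i) (\<psi> x t) + 2 * mass (index_space n w i) (\<psi> (flip i x) t)"
        by (rule query_flip_diff[OF c c])
      finally show "mass {..<?N} (\<psi> x (Suc t) - \<psi> (flip i x) (Suc t)) \<le> \<dots>" .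
    qed
    also have "\<dots> = D t + 2 * (\<Sum>(x, i)\<in>R. mass (index_space n w i) (\<psi> x t))
        + 2 * (\<Sum>(x, i)\<in>R. mass (index_space n w i) (\<psi> (flip i x) t))"
      by (simp add: D_def case_prod_unfold sum.distrib sum_distrib_left)
    also have "(\<Sum>(x, i)\<in>R. mass (index_space n w i) (\<psi> (flip i x) t))
        = (\<Sum>(y, i)\<in>R'. mass (index_space n w i) (\<psi> y t))"
      using sum.reindex_bij_betw[OF bij, of "\<lambda>(y, i). mass (index_space n w i) (\<psi> y t)"]
      by (simp add: case_prod_unfold)
    finally show ?thesis
      using sens[OF t finX, of Y] sens[OF t finY, of X] unfolding R_def R'_def by linarith
  qed
  have D: "D t \<le> real t * (2 * real (card X) + 2 * real (card Y))" if "t \<le> T" for t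
    using that
  proof (induction t)
    case 0
    \<comment> \<open>Before the first query the state cannot depend on the word.\<close>
    have "\<psi> x 0 = \<psi> y 0" for x y by (simp add: \<psi>_def)
    then have "\<psi> x 0 - \<psi> y 0 = 0\<^sub>v ?N" for x y using carrier[of 0] by (metis le0 minus_cancel_vec)
    then show ?case by (simp add: D_def mass_def)
  next
    case (Suc t)
    then show ?case using step[of t] by (simp add: algebra_simps)
  qed
  have "(\<Sum>(x, i)\<in>R. 1 / 18) \<le> D T"
    unfolding D_def
  proof (intro sum_mono, clarify)
    fix x i assume "(x, i) \<in> R"
    then have x: "length x = n" "g x" and y: "length (flip i x) = n" "\<not> g (flip i x)"
      using X Y by (auto simp: R_def)
    let ?J = "{j. j < ?N \<and> out j}"
    have px: "mass ?J (\<psi> x T) \<ge> 2 / 3"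
      using out[OF x(1)] x(2) by (simp add: output_prob_def mass_def \<psi>_def)
    have "mass {j. j < ?N \<and> \<not> out j} (\<psi> (flip i x) T) \<ge> 2 / 3"
      using out[OF y(1)] y(2) by (simp add: output_prob_def mass_def \<psi>_def)
    moreover have "mass {j. j < ?N \<and> \<not> out j} z + mass ?J z = mass {..<?N} z" for z
      unfolding mass_def by (subst sum.union_disjoint[symmetric]) (auto intro!: sum.cong)
    from this[of "\<psi> (flip i x) T"]
    have "mass {j. j < ?N \<and> \<not> out j} (\<psi> (flip i x) T) + mass ?J (\<psi> (flip i x) T) = 1"
      by (simp add: one)
    ultimately have py: "mass ?J (\<psi> (flip i x) T) \<le> 1 / 3" by linarith
    show "1 / 18 \<le> mass {..<?N} (\<psi> x T - \<psi> (flip i x) T)"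
      using carrier[of T x] carrier[of T "flip i x"]
      by (intro two_thirds_separation[OF _ _ _ px py]) auto
  qed
  then have "real (card R) \<le> 18 * D T" by simp
  then have "real (card R) \<le> 36 * real T * (real (card X) + real (card Y))"
    using D[of T] by (simp add: algebra_simps)
  \<comment> \<open>The factor \<open>d\<close> turns \<open>card X\<close> and
    \<open>card Y\<close> into terms bounded by \<open>card R\<close> each. Thus 36 = 18 * 2 doubles
    to 72, and the positive \<open>card R\<close> cancels.\<close>
  then have "real d * real (card R) \<le> real d * (36 * real T * (real (card X) + real (card Y)))"
    by (rule mult_left_mono) simp
  also have "\<dots> = 36 * real T * (real (d * card X) + real (d * card Y))"
    by (simp add: algebra_simps)
  also have "\<dots> \<le> 36 * real T * (real (card R) + real (card R))"
    using of_nat_mono[OF cardX, where 'a = real] of_nat_mono[OF cardY, where 'a = real]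
    by (intro mult_left_mono add_mono) auto
  finally have "real d * real (card R) \<le> 72 * real T * real (card R)" by simp
  moreover have "card R > 0"
    using cardX X(2) finX False by (metis card_gt_0_iff le_zero_eq mult_is_0 not_gr_zero)
  ultimately show ?thesis by simp
qed simp

subsection \<open>Reading the whole input\<close>

definition perm_mat :: "nat \<Rightarrow> (nat \<Rightarrow> nat) \<Rightarrow> complex mat" where
  "perm_mat d f = mat d d (\<lambda>(r, j). if r = f j then 1 else 0)"

lemma perm_mat_mult_unit_vec:
  assumes "j < d"
  shows "perm_mat d f *\<^sub>v unit_vec d j = unit_vec d (f j)"
  using assms by (intro eq_vecI) (auto simp: perm_mat_def unit_vec_def[of d "f j"])

lemma unitary_perm_mat:
  assumes "bij_betw f {..<d} {..<d}"
  shows "unitary d (perm_mat d f)"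
proof -
  let ?P = "perm_mat d f"
  have adj: "mat_adjoint ?P = mat d d (\<lambda>(j, r). if r = f j then 1 else 0)"
    by (auto simp: mat_adjoint_def perm_mat_def mat_of_rows_index intro!: eq_matI)
  have c: "?P \<in> carrier_mat d d" by (simp add: perm_mat_def)
  have inj: "f i = f j \<longleftrightarrow> i = j" if "i < d" "j < d" for i j
    using assms that by (auto simp: bij_betw_def inj_on_eq_iff)
  have less: "f i < d" if "i < d" for i using assms that by (auto dest: bij_betwE)
  have "mat_adjoint ?P * ?P = 1\<^sub>m d"
  proof (rule eq_matI)
    fix i j assume "i < dim_row (1\<^sub>m d)" "j < dim_col (1\<^sub>m d)"
    then have ij: "i < d" "j < d" by auto
    have "(mat_adjoint ?P * ?P) $$ (i, j)
        = (\<Sum>r<d. (if r = f i then 1 else 0) * (if r = f j then 1 else 0))"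
      unfolding adj
      using ij by (auto simp: perm_mat_def scalar_prod_def lessThan_atLeast0 intro!: sum.cong)
    also have "\<dots> = (\<Sum>r<d. if r = f i then (if i = j then 1 else 0) else 0)"
      using ij by (intro sum.cong) (auto simp: inj)
    finally show "(mat_adjoint ?P * ?P) $$ (i, j) = 1\<^sub>m d $$ (i, j)"
      using ij less by simp
  qed (use c adj in auto)
  moreover from this have "?P * mat_adjoint ?P = 1\<^sub>m d"
    by (rule mat_mult_left_right_inverse[rotated 2]) (auto simp: adj c)
  ultimately show ?thesis using c by (simp add: unitary_def)
qed

text \<open>In a finite set the complements of two images of equal size have equal size and can be
  matched arbitrarily. This completes an algorithm step prescribed only on reachable basis states to
  a permutation, hence to a unitary.\<close>

lemma inj_on_extends_to_bij:
  assumes S: "finite S" and h: "inj_on h C" "h ` C \<subseteq> S" and k: "inj_on k C" "k ` C \<subseteq> S"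
  shows "\<exists>f. bij_betw f S S \<and> (\<forall>c\<in>C. f (h c) = k c)"
proof -
  have "finite (h ` C)" "finite (k ` C)" using S h(2) k(2) finite_subset by auto
  then have "card (S - h ` C) = card (S - k ` C)"
    using h k by (simp add: card_Diff_subset card_image)
  with S obtain g where g: "bij_betw g (S - h ` C) (S - k ` C)"
    by (meson finite_Diff finite_same_card_bij)
  have "bij_betw (k \<circ> the_inv_into C h) (h ` C) (k ` C)"
    by (intro bij_betw_trans[OF bij_betw_the_inv_into]) (auto simp: bij_betw_def h k)
  then have "bij_betw (\<lambda>s. if s \<in> h ` C then (k \<circ> the_inv_into C h) s else g s)
      (h ` C \<union> (S - h ` C)) (k ` C \<union> (S - k ` C))"
    by (rule bij_betw_disjoint_Un[OF _ g]) auto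
  moreover have "h ` C \<union> (S - h ` C) = S" "k ` C \<union> (S - k ` C) = S" using h k by auto
  ultimately show ?thesis
    using h(1) by (intro exI[of _ "\<lambda>s. if s \<in> h ` C then (k \<circ> the_inv_into C h) s else g s"])
      (auto simp: the_inv_into_f_f)
qed

definition basis_index :: "nat \<Rightarrow> nat \<Rightarrow> bool \<Rightarrow> nat \<Rightarrow> nat" where
  "basis_index n i b z = of_bool b + 2 * (i + n * z)"

lemma basis_index_less:
  assumes "i < n" "z < w" shows "basis_index n i b z < 2 * n * w"
proof -
  have "n * Suc z \<le> n * w" using assms by (intro mult_left_mono) auto
  then show ?thesis using assms by (cases b) (auto simp: basis_index_def)
qed

lemma query_index_basis_index: "i < n \<Longrightarrow> query_index n (basis_index n i b z) = i"
  by (cases b) (auto simp: query_index_def basis_index_def)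

lemma basis_index_inject:
  assumes "i < n" "j < n"
  shows "basis_index n i b z = basis_index n j c y \<longleftrightarrow> i = j \<and> b = c \<and> z = y"
proof
  assume eq: "basis_index n i b z = basis_index n j c y"
  have "b = c"
    using arg_cong[OF eq, of even] by (cases b; cases c) (auto simp: basis_index_def)
  with eq have "i + n * z = j + n * y" by (simp add: basis_index_def)
  from arg_cong[OF this, of "\<lambda>a. a mod n"] arg_cong[OF this, of "\<lambda>a. a div n"] \<open>b = c\<close> assms
  show "i = j \<and> b = c \<and> z = y" by simp
qed auto

lemma query_mat_unit_vec:
  assumes i: "i < n" and z: "z < w"
  shows "query_mat n w x *\<^sub>v unit_vec (2 * n * w) (basis_index n i False z)
    = unit_vec (2 * n * w) (basis_index n i (x ! i) z)"
proof -
  have "xor (basis_index n i False z) (of_bool (x ! i)) = basis_index n i (x ! i) z"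
    by (cases "x ! i") (simp_all add: basis_index_def xor_one_eq del: One_nat_def)
  then show ?thesis
    using perm_mat_mult_unit_vec[OF basis_index_less[OF i z],
        of "\<lambda>j. xor j (of_bool (x ! query_index n j))"]
    by (simp add: perm_mat_def query_mat_def query_index_basis_index[OF i])
qed

text \<open>Needed because the infimum of the empty set of query numbers would be 0.\<close>

lemma computable_with_n_queries:
  assumes n: "n > 0"
  shows "computable_with_queries n g n"
proof -
  define P where "P = {p :: bool list. length p \<le> n}"
  have finP: "finite P"
    using finite_lists_length_le[of "UNIV :: bool set" n] by (simp add: P_def)
  define w where "w = Suc (Max (to_nat ` P))"
  have w: "to_nat p < w" if "length p \<le> n" for p :: "bool list"
    using that finP by (simp add: w_def less_Suc_eq_le P_def)
  let ?N = "2 * n * w"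
  define idx where "idx i b p = basis_index n i b (to_nat p)" for i b and p :: "bool list"
  have idx_less: "idx i b p < ?N" if "i < n" "length p \<le> n" for i b p
    using that w by (simp add: idx_def basis_index_less)
  have idx_inject: "idx i b p = idx j c q \<longleftrightarrow> i = j \<and> b = c \<and> p = q"
    if "i < n" "j < n" for i j b c p q
    using that by (simp add: idx_def basis_index_inject)
  \<comment> \<open>After query \<open>t\<close> the permutation appends the target bit to the
    recorded word, clears the target and advances the query index. Taking \<open>t mod n\<close>
    keeps the index valid after the last query.\<close>
  have ex: "\<exists>f. bij_betw f {..<?N} {..<?N} \<and> (t = 0 \<longrightarrow> f 0 = idx 0 False []) \<and>
      (0 < t \<longrightarrow> (\<forall>p b. Suc (length p) = t \<longrightarrow> f (idx (t - 1) b p) = idx (t mod n) False (p @ [b])))"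
    if t: "t \<le> n" for t
  proof (cases "t = 0")
    case True
    have "?N > 0" using n by (simp add: w_def)
    \<comment> \<open>The unit type serves as a one-point domain for prescribing the single value
      \<open>f 0\<close>.\<close>
    then have "\<exists>f. bij_betw f {..<?N} {..<?N} \<and> (\<forall>c\<in>{()}. f 0 = idx 0 False [])"
      using idx_less[of 0 "[]" False] n by (intro inj_on_extends_to_bij) auto
    with True show ?thesis by auto
  next
    case False
    let ?C = "{(p, b :: bool). Suc (length p) = t}"
    have tn: "t - 1 < n" "t mod n < n" using False t n by auto
    have inj: "inj_on (\<lambda>(p, b). idx i b p) C" "inj_on (\<lambda>(p, b). idx i False (p @ [b])) C"
      if "i < n" for i C
      using that by (auto simp: inj_on_def idx_inject)
    have range: "(\<lambda>(p, b). idx (t - 1) b p) ` ?C \<subseteq> {..<?N}"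
      "(\<lambda>(p, b). idx (t mod n) False (p @ [b])) ` ?C \<subseteq> {..<?N}"
      using t tn by (auto intro!: idx_less)
    from inj_on_extends_to_bij[OF finite_lessThan inj(1)[OF tn(1)] range(1) inj(2)[OF tn(2)] range(2)]
    obtain f where "bij_betw f {..<?N} {..<?N}" and
      "\<forall>c\<in>?C. f ((\<lambda>(p, b). idx (t - 1) b p) c) = (\<lambda>(p, b). idx (t mod n) False (p @ [b])) c"
      by blast
    with False show ?thesis by (intro exI[of _ f]) fastforce
  qed
  obtain f where f: "\<And>t. t \<le> n \<Longrightarrow> bij_betw (f t) {..<?N} {..<?N}"
      and f_0: "f 0 0 = idx 0 False []"
      and f_Suc: "\<And>t p b. Suc t \<le> n \<Longrightarrow> length p = t \<Longrightarrow>
        f (Suc t) (idx t b p) = idx (Suc t mod n) False (p @ [b])"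
  proof -
    from ex obtain f where "\<And>t. t \<le> n \<Longrightarrow> bij_betw (f t) {..<?N} {..<?N} \<and>
      (t = 0 \<longrightarrow> f t 0 = idx 0 False []) \<and>
      (0 < t \<longrightarrow> (\<forall>p b. Suc (length p) = t \<longrightarrow> f t (idx (t - 1) b p) = idx (t mod n) False (p @ [b])))"
      by metis
    then show ?thesis by (intro that[of f]) force+
  qed
  define U where "U t = perm_mat ?N (f t)" for t
  have state: "query_state n w U x t = unit_vec ?N (idx (t mod n) False (take t x))"
    if x: "length x = n" and "t \<le> n" for x t
    using \<open>t \<le> n\<close>
  proof (induction t)
    case 0
    then show ?case using n f_0 by (simp add: U_def perm_mat_mult_unit_vec w_def)
  next
    case (Suc t)
    then have t: "t < n" by simp
    have "query_mat n w x *\<^sub>v query_state n w U x t = unit_vec ?N (idx t (x ! t) (take t x))"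
      using Suc t query_mat_unit_vec[OF t w, of "take t x" x] x by (simp add: idx_def)
    moreover have "U (Suc t) *\<^sub>v unit_vec ?N (idx t (x ! t) (take t x))
        = unit_vec ?N (idx (Suc t mod n) False (take (Suc t) x))"
      using t x f_Suc[of t "take t x" "x ! t"] idx_less[of t "take t x" "x ! t"]
      by (simp add: U_def perm_mat_mult_unit_vec take_Suc_conv_app_nth)
    ultimately show ?case by simp
  qed
  define out where "out j = g (from_nat (j div 2 div n))" for j
  have "output_prob n w U out n x (g x) \<ge> 2 / 3" if x: "length x = n" for x
  proof -
    let ?j = "idx 0 False x"
    have j: "?j < ?N" using n x by (intro idx_less) auto
    have out: "out ?j = g x" using n by (simp add: out_def idx_def basis_index_def)
    have "(cmod (query_state n w U x n $ ?j))\<^sup>2 \<le> output_prob n w U out n x (g x)"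
      unfolding output_prob_def using j out
      by (intro member_le_sum[where f = "\<lambda>j. (cmod (query_state n w U x n $ j))\<^sup>2"]) auto
    then show ?thesis using state[OF x, of n] x j by simp
  qed
  moreover have "\<forall>t\<le>n. unitary ?N (U t)" using f by (simp add: U_def unitary_perm_mat)
  ultimately show ?thesis
    unfolding computable_with_queries_def
    by (intro exI[of _ w] exI[of _ U] exI[of _ out]) (auto simp: w_def)
qed

lemma query_complexity_attained:
  assumes "n > 0"
  shows "computable_with_queries n g (quantum_query_complexity n g)"
  unfolding quantum_query_complexity_def
  using Inf_nat_def1[of "{T. computable_with_queries n g T}"] computable_with_n_queries[OF assms]
  by blast

subsection \<open>Low words with many sensitive positions\<close>

text \<open>Integer bounds, possibly negative, allow the range to be shifted when a prefix is split
  off, as in \<open>stays_append\<close>.\<close>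

definition stays :: "int \<Rightarrow> int \<Rightarrow> bool list \<Rightarrow> bool" where
  "stays lo hi x \<longleftrightarrow> (\<forall>p. prefix p x \<longrightarrow> lo \<le> balance p \<and> balance p \<le> hi)"

lemma balance_Nil [simp]: "balance [] = 0"
  and balance_append [simp]: "balance (x @ y) = balance x + balance y"
  and balance_Cons [simp]: "balance (b # x) = (if b then - 1 else 1) + balance x"
  by (auto simp: balance_def)

lemma stays_append:
  "stays lo hi (x @ y) \<longleftrightarrow> stays lo hi x \<and> stays (lo - balance x) (hi - balance x) y"
  by (auto simp: stays_def prefix_append algebra_simps)

lemma stays_Nil [simp]: "stays lo hi [] \<longleftrightarrow> lo \<le> 0 \<and> 0 \<le> hi"
  by (simp add: stays_def)

lemma stays_Cons:
  "stays lo hi (b # x) \<longleftrightarrow> lo \<le> 0 \<and> 0 \<le> hi \<and>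
    stays (lo - (if b then - 1 else 1)) (hi - (if b then - 1 else 1)) x"
  by (auto simp: stays_def prefix_Cons)

lemma stays_mono: "stays lo hi x \<Longrightarrow> lo' \<le> lo \<Longrightarrow> hi \<le> hi' \<Longrightarrow> stays lo' hi' x"
  by (force simp: stays_def)

lemma DYCK_iff_stays: "DYCK k n x \<longleftrightarrow> length x = n \<and> balance x = 0 \<and> stays 0 (int k) x"
  by (simp add: DYCK_def stays_def)

section \<open>Gadgets: length, balance and height\<close>

text \<open>The words encoding bit \<open>b\<close> at level \<open>l\<close>. The balance 2m - 2(m
  + \<open>of_bool b\<close>) + 1 is again 1 or -1, as for a single bracket, so these words can
  serve as blocks of the next level.\<close>

primrec gadgets :: "nat \<Rightarrow> nat \<Rightarrow> bool \<Rightarrow> bool list set" where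
  "gadgets m 0 b = {[b]}"
| "gadgets m (Suc l) b = {concat ws @ [False] | ws bs.
     list_all2 (\<lambda>w a. w \<in> gadgets m l a) ws bs \<and>
     length bs = 2 * m \<and> count_list bs True = m + of_bool b}"

primrec gadget_length :: "nat \<Rightarrow> nat \<Rightarrow> nat" where
  "gadget_length m 0 = 1"
| "gadget_length m (Suc l) = 2 * m * gadget_length m l + 1"

lemma length_concat_uniform:
  "(\<And>w. w \<in> set ws \<Longrightarrow> length w = L) \<Longrightarrow> length (concat ws) = length ws * L"
  by (induction ws) auto

lemma length_gadget: "w \<in> gadgets m l b \<Longrightarrow> length w = gadget_length m l"
proof (induction l arbitrary: w b)
  case (Suc l)
  then obtain ws bs where w: "w = concat ws @ [False]" and
    all: "list_all2 (\<lambda>w a. w \<in> gadgets m l a) ws bs" and len: "length bs = 2 * m"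
    by auto
  have "length u = gadget_length m l" if "u \<in> set ws" for u
    using all that Suc.IH by (metis in_set_conv_nth list_all2_conv_all_nth)
  with w len list_all2_lengthD[OF all] show ?case by (simp add: length_concat_uniform)
qed simp

lemma balance_concat:
  "list_all2 (\<lambda>w b. balance w = (if b then - 1 else 1)) ws bs \<Longrightarrow>
    balance (concat ws) = int (length bs) - 2 * int (count_list bs True)"
  by (induction rule: list_all2_induct) (auto simp: algebra_simps)

lemma balance_gadget: "w \<in> gadgets m l b \<Longrightarrow> balance w = (if b then - 1 else 1)"
proof (induction l arbitrary: w b)
  case (Suc l)
  then obtain ws bs where w: "w = concat ws @ [False]" and
    all: "list_all2 (\<lambda>w a. w \<in> gadgets m l a) ws bs" and
    len: "length bs = 2 * m" "count_list bs True = m + of_bool b"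
    by auto
  have "balance (concat ws) = int (length bs) - 2 * int (count_list bs True)"
    by (intro balance_concat list_all2_mono[OF all] Suc.IH)
  with w len show ?case by simp
qed simp

text \<open>Each block changes the starting height of the later ones by at most 1, so every block
  widens the range by at most 1.\<close>

lemma stays_concat:
  assumes "\<And>w. w \<in> set ws \<Longrightarrow> stays (- a) a w \<and> \<bar>balance w\<bar> \<le> 1" "0 \<le> a"
  shows "stays (- (a + int (length ws))) (a + int (length ws)) (concat ws)"
  using assms(1)
proof (induction ws)
  case (Cons w ws)
  then have "stays (- (a + int (length ws))) (a + int (length ws)) (concat ws)"
    and w: "stays (- a) a w" "\<bar>balance w\<bar> \<le> 1"
    by auto
  then show ?case
    by (auto simp: stays_append intro: stays_mono)
qed (simp add: assms(2))

text \<open>A single bracket stays within 1, and each level adds at most 2m by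
  \<open>stays_concat\<close>, one for each block.\<close>

lemma stays_gadget: "w \<in> gadgets m l b \<Longrightarrow> stays (- int (2 * m * l + 1)) (int (2 * m * l + 1)) w"
proof (induction l arbitrary: w b)
  case (Suc l)
  let ?a = "int (2 * m * l + 1)"
  from Suc.prems obtain ws bs where w: "w = concat ws @ [False]" and
    all: "list_all2 (\<lambda>w a. w \<in> gadgets m l a) ws bs" and
    len: "length bs = 2 * m" and bs: "count_list bs True = m + of_bool b"
    by auto
  have "\<exists>c. u \<in> gadgets m l c" if "u \<in> set ws" for u
    using all that by (metis in_set_conv_nth list_all2_conv_all_nth)
  then have "stays (- ?a) ?a u \<and> \<bar>balance u\<bar> \<le> 1" if "u \<in> set ws" for u
    using Suc.IH that balance_gadget by fastforce
  then have "stays (- (?a + int (length ws))) (?a + int (length ws)) (concat ws)"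
    by (intro stays_concat) auto
  moreover define c where "c = 2 * m * Suc l + 1"
  have "?a + int (length ws) = int c"
    using list_all2_lengthD[OF all] len by (simp add: c_def)
  ultimately have "stays (- int c) (int c) (concat ws)"
    by (simp only:)
  moreover have "balance (concat ws) = (if b then - 2 else 0)"
    using balance_gadget[OF Suc.prems] w by (simp split: if_splits)
  moreover have "1 \<le> c" by (simp add: c_def)
  \<comment> \<open>For \<open>b\<close> the blocks end at height -2, which must lie in the range.
    Here m = 0 is impossible, since m + 1 ones must fit among 2m bits.\<close>
  moreover have "b \<Longrightarrow> 2 \<le> c"
    using len bs by (cases m) (auto simp: c_def)
  ultimately show ?case
    unfolding w stays_append c_def[symmetric] by (auto simp: stays_Cons)
qed (simp add: stays_Cons)

lemma gadgets_nonempty: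
  assumes "m > 0" shows "gadgets m l b \<noteq> {}"
proof (induction l arbitrary: b)
  case (Suc l)
  then have "\<forall>a. \<exists>u. u \<in> gadgets m l a" by blast
  then obtain u where u: "\<And>a. u a \<in> gadgets m l a" by metis
  \<comment> \<open>Since m > 0, the truncated subtraction is exact and the length is 2m.\<close>
  let ?bs = "replicate (m + of_bool b) True @ replicate (m - of_bool b) False"
  have "length ?bs = 2 * m" "count_list ?bs True = m + of_bool b"
    using assms by (auto simp: count_list_eq_length_filter)
  moreover have "list_all2 (\<lambda>w a. w \<in> gadgets m l a) (map u bs) bs" for bs
    by (simp add: list_all2_conv_all_nth u)
  ultimately have "concat (map u ?bs) @ [False] \<in> gadgets m (Suc l) b"
    unfolding gadgets.simps by blast
  then show ?case by blast
qed simp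

section \<open>Single flips that change the encoded bit\<close>

lemma flip_append: "flip i (x @ y) = (if i < length x then flip i x @ y else x @ flip (i - length x) y)"
  by (auto simp: flip_def nth_append list_update_append)

lemma flip_concat:
  assumes "\<And>w. w \<in> set ws \<Longrightarrow> length w = L" "j < length ws" "i < L"
  shows "flip (j * L + i) (concat ws) = concat (ws[j := flip i (ws ! j)])"
  using assms
proof (induction ws arbitrary: j)
  case (Cons w ws)
  then show ?case by (cases j) (auto simp: flip_append add.assoc)
qed simp

lemma count_list_update:
  assumes "j < length xs" "xs ! j \<noteq> y"
  shows "count_list (xs[j := y]) y = Suc (count_list xs y)"
  using assms
proof (induction xs arbitrary: j)
  case (Cons x xs)
  then show ?case by (cases j) auto
qed simp

lemma count_list_update_other:
  assumes "j < length xs" "y \<noteq> xs ! j"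
  shows "Suc (count_list (xs[j := y]) (xs ! j)) = count_list xs (xs ! j)"
  using assms
proof (induction xs arbitrary: j)
  case (Cons x xs)
  then show ?case by (cases j) auto
qed simp

text \<open>At least m blocks encode \<open>b\<close> itself: there are m + 1 ones if
  \<open>b\<close> holds and m zeros otherwise. Changing the bit of any one of them changes the bit
  of the whole gadget, so the number of good flips multiplies by m per level.\<close>

lemma gadget_sensitivity:
  "w \<in> gadgets m l b \<Longrightarrow> m ^ l \<le> card {i. i < gadget_length m l \<and> flip i w \<in> gadgets m l (\<not> b)}"
proof (induction l arbitrary: w b)
  case 0
  have "{i. i < 1 \<and> flip i [b] \<in> {[\<not> b]}} = {0 :: nat}" by (auto simp: flip_def)
  with 0 show ?case by simp
next
  case (Suc l)
  then obtain ws bs where w: "w = concat ws @ [False]" and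
    all: "list_all2 (\<lambda>w a. w \<in> gadgets m l a) ws bs" and
    len: "length bs = 2 * m" and count: "count_list bs True = m + of_bool b"
    by auto
  let ?L = "gadget_length m l"
  have lenws: "length ws = 2 * m" using list_all2_lengthD[OF all] len by simp
  have L: "length u = ?L" if "u \<in> set ws" for u
    using all that length_gadget by (metis in_set_conv_nth list_all2_conv_all_nth)
  define J where "J = {j. j < 2 * m \<and> bs ! j = b}"
  define S where "S j = {i. i < ?L \<and> flip i (ws ! j) \<in> gadgets m l (\<not> b)}" for j
  have "card {j. j < length bs \<and> bs ! j = b} = count_list bs b"
    by (simp add: count_list_eq_length_filter length_filter_conv_card eq_commute)
  moreover have "count_list bs True + count_list bs False = length bs"
    by (induction bs) auto
  ultimately have cardJ: "m \<le> card J"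
    using len count by (cases b) (auto simp: J_def)
  have cardS: "m ^ l \<le> card (S j)" if "j \<in> J" for j
    using Suc.IH[of "ws ! j" b] list_all2_nthD2[OF all, of j] that len by (simp add: J_def S_def)
  have sens: "flip (j * ?L + i) w \<in> gadgets m (Suc l) (\<not> b)"
    and pos: "j * ?L + i < gadget_length m (Suc l)" if "j \<in> J" "i \<in> S j" for j i
  proof -
    have j: "j < 2 * m" "bs ! j = b" and i: "i < ?L" "flip i (ws ! j) \<in> gadgets m l (\<not> b)"
      using that by (auto simp: J_def S_def)
    have "Suc j * ?L \<le> 2 * m * ?L" using j by (intro mult_le_mono1) simp
    then have lt: "j * ?L + i < 2 * m * ?L" using i by simp
    then show "j * ?L + i < gadget_length m (Suc l)" by simp
    have "flip (j * ?L + i) w = concat (ws[j := flip i (ws ! j)]) @ [False]"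
      using flip_concat[of ws ?L j i] L j i lenws lt
      by (simp add: w flip_append length_concat_uniform[of ws ?L])
    moreover have "list_all2 (\<lambda>w a. w \<in> gadgets m l a) (ws[j := flip i (ws ! j)]) (bs[j := \<not> b])"
      using all i(2) by (rule list_all2_update_cong)
    moreover have "count_list (bs[j := \<not> b]) True = m + of_bool (\<not> b)"
      using count_list_update[of j bs True] count_list_update_other[of j bs False] count len j
      by (cases b) auto
    ultimately show "flip (j * ?L + i) w \<in> gadgets m (Suc l) (\<not> b)"
      using len by (auto intro!: exI[of _ "ws[j := flip i (ws ! j)]"] exI[of _ "bs[j := \<not> b]"])
  qed
  have fin: "finite J" "\<And>j. finite (S j)" by (auto simp: J_def S_def)
  \<comment> \<open>Block number and offset are recovered from the position by division by the block
    length, so flips in different blocks are counted separately.\<close>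
  have inj: "inj_on (\<lambda>(j, i). j * ?L + i) (SIGMA j:J. S j)"
  proof (rule inj_onI, clarify)
    fix j i j' i' assume "i \<in> S j" "i' \<in> S j'" and eq: "j * ?L + i = j' * ?L + i'"
    then have "i < ?L" "i' < ?L" by (auto simp: S_def)
    with arg_cong[OF eq, of "\<lambda>a. a div ?L"] arg_cong[OF eq, of "\<lambda>a. a mod ?L"]
    show "j = j' \<and> i = i'" by simp
  qed
  have "m ^ Suc l \<le> card J * m ^ l" using cardJ by simp
  also have "\<dots> \<le> card (SIGMA j:J. S j)"
    using sum_bounded_below[of J "m ^ l" "\<lambda>j. card (S j)"] cardS fin by simp
  also have "\<dots> = card ((\<lambda>(j, i). j * ?L + i) ` (SIGMA j:J. S j))"
    by (rule card_image[OF inj, symmetric])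
  also have "\<dots> \<le> card {i. i < gadget_length m (Suc l) \<and> flip i w \<in> gadgets m (Suc l) (\<not> b)}"
    using sens pos by (intro card_mono) (auto simp del: gadgets.simps gadget_length.simps)
  finally show ?case .
qed

section \<open>Framing gadgets as Dyck words\<close>

lemma odd_gadget_length: "odd (gadget_length m l)"
  by (cases l) auto

lemma gadget_length_le: "gadget_length m l \<le> (2 * m + 1) ^ l"
proof (induction l)
  case (Suc l)
  then have "2 * m * gadget_length m l \<le> 2 * m * (2 * m + 1) ^ l"
    by (rule mult_le_mono2)
  moreover have "1 \<le> (2 * m + 1) ^ l" by simp
  ultimately have "gadget_length m (Suc l) \<le> 2 * m * (2 * m + 1) ^ l + (2 * m + 1) ^ l"
    unfolding gadget_length.simps by (rule add_mono)
  then show ?case by simp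
qed simp

lemma stays_replicate:
  "stays lo hi (replicate k b) \<longleftrightarrow>
    lo \<le> 0 \<and> 0 \<le> hi \<and> (if b then lo \<le> - int k else int k \<le> hi)"
  by (induction k arbitrary: lo hi) (auto simp: stays_Cons)

lemma balance_replicate [simp]: "balance (replicate k b) = (if b then - int k else int k)"
  by (induction k) auto

text \<open>Padding of height 1 and balance 0, used to reach every sufficiently large even length
  exactly.\<close>

definition zigzag :: "nat \<Rightarrow> bool list" where
  "zigzag p = concat (replicate p [False, True])"

lemma length_zigzag [simp]: "length (zigzag p) = 2 * p"
  and balance_zigzag [simp]: "balance (zigzag p) = 0"
  by (induction p) (auto simp: zigzag_def)

lemma stays_zigzag: "stays 0 1 (zigzag p)"
  by (induction p) (auto simp: zigzag_def stays_Cons)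

text \<open>With h = 2ml + 1, the \<open>h\<close> opening brackets lift the gadget's path from the
  range [-h, h] to [0, 2h], and 2h + 1 = 4ml + 3 \<le> k. The h + 1 closing brackets then end at 0
  for gadgets of balance 1 and at -2 for those of balance -1. Flips inside the gadget commute with
  the framing.\<close>

lemma DYCK_complexity_lower_bound:
  assumes m: "m > 0" and k: "4 * m * l + 3 \<le> k"
    and n: "even n" "4 * m * l + 3 + gadget_length m l \<le> n"
  shows "real (m ^ l) \<le> 72 * real (quantum_query_complexity n (DYCK k n))"
proof -
  define h where "h = 2 * m * l + 1"
  \<comment> \<open>The gadget has odd length, so the remaining length is even and the halving is
    exact.\<close>
  define q where "q = (n - (2 * h + 1 + gadget_length m l)) div 2"
  define pre where "pre = zigzag q @ replicate h False"
  define embed where "embed w = pre @ w @ replicate (h + 1) True" for w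
  have n_eq: "n = 2 * q + h + gadget_length m l + (h + 1)"
  proof -
    have "2 * h + 1 + gadget_length m l \<le> n" using n(2) by (simp add: h_def)
    moreover from this have "even (n - (2 * h + 1 + gadget_length m l))"
      using n(1) odd_gadget_length[of m l] by simp
    ultimately show ?thesis unfolding q_def by simp
  qed
  have pre: "length pre = 2 * q + h" "balance pre = int h" by (simp_all add: pre_def)
  have h: "2 * h + 1 \<le> k" "1 \<le> h" using k by (simp_all add: h_def)
  have stays_pre: "stays 0 (int k) pre"
    using h by (auto simp: pre_def stays_append stays_replicate intro: stays_mono[OF stays_zigzag])
  have len: "length (embed w) = n" if "w \<in> gadgets m l b" for w b
    using length_gadget[OF that] by (simp add: embed_def pre n_eq)
  have bal: "balance (embed w) = (if b then - 2 else 0)" if "w \<in> gadgets m l b" for w b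
    using balance_gadget[OF that] by (simp add: embed_def pre)
  have yes: "DYCK k n (embed w)" if w: "w \<in> gadgets m l False" for w
  proof -
    have "stays (- int h) (int k - int h) w"
      using stays_gadget[OF w] h unfolding h_def[symmetric] by (auto intro: stays_mono)
    then have "stays 0 (int k) (embed w)"
      using balance_gadget[OF w] h
      by (simp add: embed_def stays_append stays_pre pre stays_Cons stays_replicate)
    then show ?thesis using len[OF w] bal[OF w] by (simp add: DYCK_iff_stays)
  qed
  have no: "\<not> DYCK k n (embed w)" if "w \<in> gadgets m l True" for w
    using bal[OF that] by (simp add: DYCK_iff_stays)
  have sens: "m ^ l \<le> card {i. i < n \<and> flip i (embed w) \<in> embed ` gadgets m l (\<not> b)}"
    if w: "w \<in> gadgets m l b" for w b
  proof -
    have "flip (length pre + i) (embed w) = embed (flip i w)" if "i < gadget_length m l" for i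
      using that length_gadget[OF w] by (simp add: embed_def flip_append)
    then have "(\<lambda>i. length pre + i) ` {i. i < gadget_length m l \<and> flip i w \<in> gadgets m l (\<not> b)}
        \<subseteq> {i. i < n \<and> flip i (embed w) \<in> embed ` gadgets m l (\<not> b)}"
      by (auto simp: n_eq pre(1))
    then have "card {i. i < gadget_length m l \<and> flip i w \<in> gadgets m l (\<not> b)}
        \<le> card {i. i < n \<and> flip i (embed w) \<in> embed ` gadgets m l (\<not> b)}"
      by (intro card_inj_on_le[where f = "\<lambda>i. length pre + i"]) auto
    with gadget_sensitivity[OF w] show ?thesis by simp
  qed
  have "n > 0" by (simp add: n_eq)
  from query_complexity_attained[OF this] show ?thesis
  proof (rule adversary_lower_bound[where X = "embed ` gadgets m l False" and Y = "embed ` gadgets m l True"])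
    show "embed ` gadgets m l False \<noteq> {}" using gadgets_nonempty[OF m] by simp
  qed (use len yes no sens[of _ False] sens[of _ True] in auto)
qed

section \<open>Choice of depth and branching\<close>

lemma obtain_gadget_depth:
  fixes m n :: nat
  assumes "2 \<le> m" "8 * m \<le> n"
  obtains l where "l > 0" "(8 * m) ^ l \<le> n" "n < (8 * m) ^ Suc l"
proof -
  obtain l where l: "(8 * m) ^ l \<le> n" "n < (8 * m) ^ (l + 1)"
    using ex_power_ivl1[of "8 * m" n] assms by auto
  moreover have "l > 0" using l assms by (cases l) auto
  ultimately show ?thesis using that by simp
qed

text \<open>The left side grows by a factor of at most 2m + 1 per level. The base 8m and the
  condition m \<ge> 2 come from the first level, where 6m + 4 \<le> 8m is needed.\<close>

lemma padded_gadget_length_le: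
  assumes "2 \<le> m" "l > 0"
  shows "4 * m * l + 3 + gadget_length m l \<le> (8 * m) ^ l"
proof -
  have "4 * m * l + 3 + (2 * m + 1) ^ l \<le> (8 * m) ^ l"
    using assms(2)
  proof (induction l rule: nat_induct_non_zero)
    case 1
    show ?case using assms by simp
  next
    case (Suc l)
    have "4 * m * Suc l + 3 + (2 * m + 1) ^ Suc l \<le> (2 * m + 1) * (4 * m * l + 3 + (2 * m + 1) ^ l)"
      using assms Suc.hyps by (simp add: algebra_simps)
    also have "\<dots> \<le> 8 * m * (8 * m) ^ l"
      using Suc.IH assms by (intro mult_le_mono) auto
    finally show ?case by simp
  qed
  then show ?thesis using gadget_length_le[of m l] by simp
qed

text \<open>The choice of m gives 8 \<le> m^\<epsilon>, hence (8m)^(1-\<epsilon>) \<le> m. For n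
  between (8m)^l and (8m)^(l+1) this yields n^(1-\<epsilon>) \<le> m^(l+1), which exceeds the
  sensitivity m^l only by the constant factor m.\<close>

lemma DYCK_complexity_ge_powr:
  fixes \<epsilon> :: real
  assumes \<epsilon>: "\<epsilon> > 0" "\<epsilon> \<le> 1" and m: "2 \<le> m" "8 powr (1 / \<epsilon>) \<le> real m"
    and n: "even n" "8 * m \<le> n"
  shows "real n powr (1 - \<epsilon>) \<le>
    72 * real m * real (quantum_query_complexity n (DYCK (nat \<lfloor>(4 * m) * log 2 (real n)\<rfloor>) n))"
proof -
  let ?M = "real (8 * m)"
  obtain l where l: "l > 0" "(8 * m) ^ l \<le> n" "n < (8 * m) ^ Suc l"
    using obtain_gadget_depth[OF m(1) n(2)] .
  have Mpow: "real ((8 * m) ^ k) = ?M powr real k" for k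
    using m by (simp add: powr_realpow)
  have "(8::real) = (8 powr (1 / \<epsilon>)) powr \<epsilon>" using \<epsilon> by (simp add: powr_powr)
  also have "\<dots> \<le> real m powr \<epsilon>" using m \<epsilon> by (intro powr_mono2) auto
  finally have "8 \<le> real m powr \<epsilon>" .
  moreover have "8 powr (1 - \<epsilon>) \<le> (8::real) powr 1" using \<epsilon> by (intro powr_mono) auto
  ultimately have "?M powr (1 - \<epsilon>) \<le> real m powr \<epsilon> * real m powr (1 - \<epsilon>)"
    using m by (simp add: powr_mult mult_right_mono)
  also have "\<dots> = real m" using m by (simp flip: powr_add)
  finally have M: "?M powr (1 - \<epsilon>) \<le> real m" .
  have "real n powr (1 - \<epsilon>) \<le> real ((8 * m) ^ Suc l) powr (1 - \<epsilon>)"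
    using of_nat_mono[OF less_imp_le[OF l(3)], where 'a = real] \<epsilon> by (intro powr_mono2) auto
  also have "\<dots> = (?M powr (1 - \<epsilon>)) ^ Suc l"
    unfolding Mpow using m by (subst powr_realpow[symmetric]) (simp_all add: powr_powr mult.commute)
  also have "\<dots> \<le> real m ^ Suc l" using M by (intro power_mono) auto
  finally have le: "real n powr (1 - \<epsilon>) \<le> real m * real (m ^ l)" by simp
  have "4 * m * l + 3 \<le> nat \<lfloor>(4 * m) * log 2 (real n)\<rfloor>"
  proof -
    \<comment> \<open>Bounding 8m below by 4 gives 2l \<le> log n; the spare factor 2 absorbs the
      additive 3 in the height.\<close>
    have "2 ^ (2 * l) \<le> (8 * m) ^ l" unfolding power_mult using m by (intro power_mono) auto
    then have "(2::nat) ^ (2 * l) \<le> n" using l by simp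
    then have "real (2 ^ (2 * l)) \<le> real n" by (simp only: of_nat_le_iff)
    then have "2 powr (real (2 * l)) \<le> real n" by (subst powr_realpow) auto
    then have "real (2 * l) \<le> log 2 (real n)"
      using n m by (subst le_log_iff) auto
    then have "real (4 * m) * real (2 * l) \<le> (4 * m) * log 2 (real n)"
      by (intro mult_left_mono) auto
    moreover have "4 * m * l + 3 \<le> 4 * m * (2 * l)"
    proof -
      have "1 \<le> m * l" using m l by simp
      then have "3 \<le> 4 * (m * l)" by linarith
      then show ?thesis by (simp add: mult_ac)
    qed
    then have "real (4 * m * l + 3) \<le> real (4 * m) * real (2 * l)"
      by (simp only: of_nat_mult[symmetric] of_nat_le_iff)
    ultimately show ?thesis by linarith
  qed
  moreover have "4 * m * l + 3 + gadget_length m l \<le> n"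
    using padded_gadget_length_le[OF m(1) l(1)] l(2) by simp
  ultimately have "real (m ^ l) \<le>
      72 * real (quantum_query_complexity n (DYCK (nat \<lfloor>(4 * m) * log 2 (real n)\<rfloor>) n))"
    using DYCK_complexity_lower_bound[of m l _ n] m n by simp
  then have "real m * real (m ^ l) \<le> real m *
      (72 * real (quantum_query_complexity n (DYCK (nat \<lfloor>(4 * m) * log 2 (real n)\<rfloor>) n)))"
    by (rule mult_left_mono) simp
  with le show ?thesis by (simp add: mult_ac)
qed

theorem theorem5:
  fixes \<epsilon> :: real
  assumes "\<epsilon> > 0"
  shows "\<exists>c::real. c > 0 \<and>
    (\<lambda>n. real (quantum_query_complexity n (DYCK (nat \<lfloor>c * log 2 (real n)\<rfloor>) n)))
      \<in> \<Omega>[inf sequentially (principal {n. even n})](\<lambda>n. real n powr (1 - \<epsilon>))"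
proof -
  \<comment> \<open>For \<epsilon> > 1 the bound with exponent 1 - \<delta> = 0 is stronger than the
    one required.\<close>
  define \<delta> where "\<delta> = min \<epsilon> 1"
  define m where "m = max 2 (nat \<lceil>8 powr (1 / \<delta>)\<rceil>)"
  have \<delta>: "\<delta> > 0" "\<delta> \<le> 1" "\<delta> \<le> \<epsilon>" using assms by (auto simp: \<delta>_def)
  have m: "2 \<le> m" "8 powr (1 / \<delta>) \<le> real m"
    unfolding m_def by (simp, linarith)
  let ?Q = "\<lambda>n. real (quantum_query_complexity n (DYCK (nat \<lfloor>real (4 * m) * log 2 (real n)\<rfloor>) n))"
  have "1 / (72 * real m) * real n powr (1 - \<epsilon>) \<le> ?Q n" if "even n" "8 * m \<le> n" for n
  proof -
    have "real n powr (1 - \<epsilon>) \<le> real n powr (1 - \<delta>)"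
      using that m \<delta> by (intro powr_mono) auto
    also have "\<dots> \<le> 72 * real m * ?Q n"
      using DYCK_complexity_ge_powr[OF \<delta>(1,2) m that] by simp
    finally show ?thesis using m by (simp add: field_simps)
  qed
  then have "eventually (\<lambda>n. even n \<longrightarrow> 1 / (72 * real m) * real n powr (1 - \<epsilon>) \<le> ?Q n) sequentially"
    by (intro eventually_mono[OF eventually_ge_at_top[of "8 * m"]]) blast
  then have "?Q \<in> \<Omega>[inf sequentially (principal {n. even n})](\<lambda>n. real n powr (1 - \<epsilon>))"
    using m by (intro landau_omega.bigI[of "1 / (72 * real m)"]) (auto simp: eventually_inf_principal)
  then show ?thesis using m by (intro exI[of _ "real (4 * m)"]) auto
qed

end
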